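(* Let $\alpha\in(0.5,+\infty)$. Even when $N=2$, for every Markovian policy whose (anonymous) probability function $Q$ is unradical and $\alpha$-irreversible, there exists an instance $\Theta$ (not depending on $T$) under which an $\Omega(T)$ regret is incurred with probability $\Omega(T^{-o(1)})$; that is, there is a constant $c>0$ such that $$\Pr\Big(\sum_{t=1}^T(\mu^*-\mu_{a(t)})\ge cT\Big)=\Omega(T^{-o(1)})\quad\text{as }T\to\infty .$$ Therefore the worst-case regret satisfies $\mathcal R(T)=\Omega(T^{1-o(1)})$.
   Context: Bandit problem. There are $N$ arms, $[N]=\{1,\dots,N\}$ (here $N=2$). Each arm $i$ has an i.i.d. reward sequence $\{r_i(t)\}_{t\ge1}$ drawn from a fixed distribution supported on $[0,1]$ with mean $\mu_i$; the collection of reward distributions is the instance $\Theta$. The optimal arm $i^*=\arg\max_i\mu_i$ is assumed unique, and $\mu^*=\max_i\mu_i$. At each time $t=1,2,\dots$ an action $a(t)\in[N]$ is chosen and the reward $r_{a(t)}(t)$ is observed; conditionally on the past and on $a(t)=i$, this reward has arm $i$'s distribution. The regret on instance $\Theta$ is $\mathcal R^\Theta(T)=\mu^*T-\mathbb E\big[\sum_{t=1}^T r_{a(t)}(t)\big]=\mathbb E\big[\sum_{t=1}^T(\mu^*-\mu_{a(t)})\big]$ and the worst-case regret is $\mathcal R(T)=\sup_\Theta\mathcal R^\Theta(T)$, the supremum being over all $N$-armed instances, separately for each $T$. Markovian policies. Let $k_i(t)=\sum_{\ell=1}^{t-1}\mathbb I\{a(\ell)=i\}$ and $\hat\mu_i(t)=\frac{1}{k_i(t)+1}\sum_{\ell\le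 t-1:\,a(\ell)=i} r_i(\ell)$. The state at time $t$ is $\mathbf S(t)=(k_1(t),\dots,k_N(t),\hat\mu_1(t),\dots,\hat\mu_N(t))\in\mathcal S=\mathbb Z_+^N\times[0,1]^N$, where $\mathbb Z_+=\{0,1,2,\dots\}$. A policy is given by a function $Q=(Q_1,\dots,Q_N)$ from $\mathcal S$ to the probability vectors on $[N]$ (not depending on $T$): given the history up to time $t$, arm $i$ is pulled with probability $Q_i(\mathbf S(t))$. A state is written $(\kappa,u)$, $\kappa\in\mathbb Z_+^N$, $u\in[0,1]^N$. Anonymous (standing assumption on $Q$): for every permutation $\sigma$ of $[N]$, every $i$ and every state, $Q_i(\kappa_{\sigma(1)},\dots,\kappa_{\sigma(N)},u_{\sigma(1)},\dots,u_{\sigma(N)})=Q_{\sigma(i)}(\kappa_1,\dots,\kappa_N,u_1,\dots,u_N)$. Unradical: $Q_1(\kappa,u)\le\frac12$ for every $\kappa\in\mathbb Z_+^N$ and $u\in[0,1]^N$ with $u_1\le\min\{u_2,\dots,u_N\}$. $\alpha$-irreversible (for $\alpha>0.5$): for every constant $\delta\in(0,2\alpha)$ (however small), every arm $j>1$, every sequence $u=u(T)\in[0,1]^N$ with $u_j-u_1=\Omega(1)$, and every sequence $\kappa=\kappa(T)\in\mathbb Z_+^N$ with $\kappa_1,\kappa_j\ge(\log T)^{\frac{1}{2\alpha-\delta}}$ for all sufficiently large $T$, one has, for all sufficiently large $T$, $$Q_1(\kappa,u)\le\frac{(\log T)^{\frac{1}{2\alpha-\delta}}}{T}.$$ Notation: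 $f(T)=\Omega(g(T))$ means $\liminf_{T\to\infty}f(T)/g(T)>0$; for a constant $b$, $f(T)=\Omega(T^{b-o(1)})$ means that $f(T)=\Omega(T^{b-\eta_T})$ for some sequence $\eta_T\to0$. *)

theory Defs
  imports "HOL-Probability.Probability"
begin

section \<open>Asymptotic notation\<close>

text \<open>
  This is the signed notion, \<open>liminf f/g > 0\<close>. The symbol \<open>\<Omega>\<close> of the Landau library compares
  absolute values and is therefore not suitable for differences such as \<open>u\<^sub>j - u\<^sub>1\<close>.
\<close>

definition is_Omega :: "(nat \<Rightarrow> real) \<Rightarrow> (nat \<Rightarrow> real) \<Rightarrow> bool" where
  "is_Omega f g \<longleftrightarrow> liminf (\<lambda>T. ereal (f T / g T)) > 0"

definition is_Omega_powr_o1 :: "(nat \<Rightarrow> real) \<Rightarrow> real \<Rightarrow> bool" where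
  "is_Omega_powr_o1 f b \<longleftrightarrow>
     (\<exists>\<eta>. \<eta> \<longlonglongrightarrow> 0 \<and> is_Omega f (\<lambda>T. real T powr (b - \<eta> T)))"


section \<open>Instances\<close>

abbreviation unit_borel :: "real measure" where
  "unit_borel \<equiv> restrict_space borel {0..1}"

type_synonym 'n bandit = "'n \<Rightarrow> real measure"

definition mean :: "'n bandit \<Rightarrow> 'n \<Rightarrow> real" where
  "mean \<Theta> i = (\<integral>x. x \<partial>\<Theta> i)"

definition opt_mean :: "'n::finite bandit \<Rightarrow> real" where
  "opt_mean \<Theta> = Max (range (mean \<Theta>))"

definition instances :: "'n::finite bandit set" where
  "instances = {\<Theta>. (\<forall>i. prob_space (\<Theta> i) \<and> sets (\<Theta> i) = sets unit_borel) \<and>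
                    (\<exists>!i. mean \<Theta> i = opt_mean \<Theta>)}"


section \<open>Markovian policies\<close>

text \<open>
  The arms are the elements of a finite type \<open>'n\<close>; the distinguished arm (arm 1) is
  \<open>1 :: 'n\<close>. For two arms, \<open>'n\<close> is the numeral type \<open>2\<close>, with elements \<open>1\<close> and \<open>2 = 0\<close>.
  In a state \<open>(\<kappa>, u)\<close>, arm \<open>i\<close> is pulled with probability \<open>pmf (Q \<kappa> u) i\<close>. The values of \<open>Q\<close> at
  arguments \<open>u\<close> outside the unit cube are irrelevant. Measurability in \<open>u\<close> is what makes
  the law of the induced process well defined for arbitrary reward distributions.
\<close>

type_synonym 'n policy = "('n \<Rightarrow> nat) \<Rightarrow> ('n \<Rightarrow> real) \<Rightarrow> 'n pmf"

definition cube :: "('n \<Rightarrow> real) set" where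
  "cube = UNIV \<rightarrow> {0..1}"

definition markov_policy :: "'n policy \<Rightarrow> bool" where
  "markov_policy Q \<longleftrightarrow>
     (\<forall>\<kappa> i. (\<lambda>u. pmf (Q \<kappa> u) i) \<in> borel_measurable (Pi\<^sub>M UNIV (\<lambda>_. unit_borel)))"

definition anonymous :: "'n policy \<Rightarrow> bool" where
  "anonymous Q \<longleftrightarrow>
     (\<forall>\<sigma>. bij \<sigma> \<longrightarrow> (\<forall>i \<kappa>. \<forall>u\<in>cube.
        pmf (Q (\<lambda>k. \<kappa> (\<sigma> k)) (\<lambda>k. u (\<sigma> k))) i = pmf (Q \<kappa> u) (\<sigma> i)))"

definition unradical :: "'n::{finite, one} policy \<Rightarrow> bool" where
  "unradical Q \<longleftrightarrow>
     (\<forall>\<kappa>. \<forall>u\<in>cube. (\<forall>j. j \<noteq> 1 \<longrightarrow> u 1 \<le> u j) \<longrightarrow> pmf (Q \<kappa> u) 1 \<le> 1 / 2)"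

definition irreversible :: "real \<Rightarrow> 'n::{finite, one} policy \<Rightarrow> bool" where
  "irreversible \<alpha> Q \<longleftrightarrow>
     (\<forall>\<delta>\<in>{0<..<2 * \<alpha>}. \<forall>j. j \<noteq> 1 \<longrightarrow>
       (\<forall>(u :: nat \<Rightarrow> 'n \<Rightarrow> real) (\<kappa> :: nat \<Rightarrow> 'n \<Rightarrow> nat).
          (\<forall>T. u T \<in> cube) \<longrightarrow>
          is_Omega (\<lambda>T. u T j - u T 1) (\<lambda>_. 1) \<longrightarrow>
          (\<forall>\<^sub>F T in sequentially.
             real (\<kappa> T 1) \<ge> ln (real T) powr (1 / (2 * \<alpha> - \<delta>)) \<and>
             real (\<kappa> T j) \<ge> ln (real T) powr (1 / (2 * \<alpha> - \<delta>))) \<longrightarrow>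
          (\<forall>\<^sub>F T in sequentially.
             pmf (Q (\<kappa> T) (u T)) 1 \<le> ln (real T) powr (1 / (2 * \<alpha> - \<delta>)) / real T)))"


section \<open>The process generated by a policy\<close>

text \<open>
  A trajectory is a sequence of pairs (arm pulled, reward observed). Time is counted from 0:
  \<open>\<omega> t\<close> belongs to round \<open>t + 1\<close>, and \<open>pulls \<omega> t\<close>, \<open>emp_mean \<omega> t\<close> form the state at the
  beginning of that round. The empirical mean divides by the number of pulls plus one.
\<close>

definition pulls :: "(nat \<Rightarrow> 'n \<times> real) \<Rightarrow> nat \<Rightarrow> 'n \<Rightarrow> nat" where
  "pulls \<omega> t i = card {l. l < t \<and> fst (\<omega> l) = i}"

definition emp_mean :: "(nat \<Rightarrow> 'n \<times> real) \<Rightarrow> nat \<Rightarrow> 'n \<Rightarrow> real" where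
  "emp_mean \<omega> t i = (\<Sum>l | l < t \<and> fst (\<omega> l) = i. snd (\<omega> l)) / (real (pulls \<omega> t i) + 1)"

definition round_space :: "('n \<times> real) measure" where
  "round_space = count_space UNIV \<Otimes>\<^sub>M unit_borel"

text \<open>Conditional law of (arm, reward) in a round given the past: draw an arm from \<open>Q\<close> at the
  current state, then a reward from that arm's distribution.\<close>

definition round_law ::
    "'n bandit \<Rightarrow> 'n policy \<Rightarrow> nat \<Rightarrow> (nat \<Rightarrow> 'n \<times> real) \<Rightarrow> ('n \<times> real) measure" where
  "round_law \<Theta> Q t \<omega> =
     measure_pmf (Q (pulls \<omega> t) (emp_mean \<omega> t)) \<bind> (\<lambda>i. distr (\<Theta> i) round_space (Pair i))"

text \<open>The Ionescu-Tulcea measure of the kernels \<open>round_law\<close>; inside the library locale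
  this is \<open>PF.lim\<close>.\<close>

definition trajectory_law :: "'n bandit \<Rightarrow> 'n policy \<Rightarrow> (nat \<Rightarrow> 'n \<times> real) measure" where
  "trajectory_law \<Theta> Q =
     projective_family.lim UNIV (Ionescu_Tulcea.CI (round_law \<Theta> Q) (\<lambda>_. round_space))
       (\<lambda>_. round_space)"

lemma space_round_space: "space round_space = UNIV \<times> {0..1}"
  by (simp add: round_space_def space_pair_measure space_restrict_space)

lemma measurable_Pair_round_space:
  assumes "sets N = sets unit_borel"
  shows "Pair i \<in> N \<rightarrow>\<^sub>M round_space"
  unfolding round_space_def measurable_cong_sets[OF assms refl] by measurable

lemma measurable_fst_round:
  "l < (t::nat) \<Longrightarrow> (\<lambda>\<omega>. fst (\<omega> l)) \<in> Pi\<^sub>M {0..<t} (\<lambda>_. round_space) \<rightarrow>\<^sub>M count_space UNIV"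
  by (rule measurable_compose[OF measurable_component_singleton]) (auto simp: round_space_def)

lemma measurable_snd_round:
  "l < (t::nat) \<Longrightarrow> (\<lambda>\<omega>. snd (\<omega> l)) \<in> borel_measurable (Pi\<^sub>M {0..<t} (\<lambda>_. round_space))"
  by (rule measurable_compose[OF measurable_component_singleton])
    (auto simp: round_space_def intro!: measurable_compose[OF measurable_snd] measurable_restrict_space1)

lemma pulls_eq_sum: "pulls \<omega> t i = (\<Sum>l<t. if fst (\<omega> l) = i then 1 else 0)"
proof -
  have "{l. l < t \<and> fst (\<omega> l) = i} = {..<t} \<inter> {l. fst (\<omega> l) = i}" by auto
  then show ?thesis by (simp add: pulls_def sum.If_cases)
qed

lemma reward_sum_eq:
  fixes \<omega> :: "nat \<Rightarrow> 'n \<times> real"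
  shows "(\<Sum>l | l < t \<and> fst (\<omega> l) = i. snd (\<omega> l)) =
    (\<Sum>l<t. if fst (\<omega> l) = i then snd (\<omega> l) else 0)"
proof -
  have "{l. l < t \<and> fst (\<omega> l) = i} = {..<t} \<inter> {l. fst (\<omega> l) = i}" by auto
  then show ?thesis
    using sum.inter_restrict[OF finite_lessThan, of "\<lambda>l. snd (\<omega> l)" t "{l. fst (\<omega> l) = i}"] by simp
qed

lemma pred_fst_round:
  "l < (t::nat) \<Longrightarrow> Measurable.pred (Pi\<^sub>M {0..<t} (\<lambda>_. round_space)) (\<lambda>\<omega>. fst (\<omega> l) = i)"
  by (rule measurable_compose[OF measurable_fst_round]) auto

lemma measurable_pulls:
  "(\<lambda>\<omega>. pulls \<omega> t i) \<in> Pi\<^sub>M {0..<t} (\<lambda>_. round_space) \<rightarrow>\<^sub>M count_space UNIV"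
  unfolding pulls_eq_sum by (intro measurable_sum_nat measurable_If pred_fst_round[unfolded pred_def]) auto

lemma emp_mean_bounds:
  assumes "\<omega> \<in> space (Pi\<^sub>M {0..<t} (\<lambda>_. round_space))"
  shows "emp_mean \<omega> t i \<in> {0..1}"
proof -
  have *: "snd (\<omega> l) \<in> {0..1}" if "l < t" for l
    using assms that by (auto simp: space_PiM PiE_iff space_round_space mem_Times_iff)
  let ?A = "{l. l < t \<and> fst (\<omega> l) = i}"
  have "(\<Sum>l\<in>?A. snd (\<omega> l)) \<le> (\<Sum>l\<in>?A. 1)" using * by (intro sum_mono) auto
  moreover have "(\<Sum>l\<in>?A. snd (\<omega> l)) \<ge> 0" using * by (intro sum_nonneg) auto
  ultimately show ?thesis by (auto simp: emp_mean_def pulls_def divide_simps)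
qed

lemma measurable_emp_mean:
  "(\<lambda>\<omega>. emp_mean \<omega> t) \<in> Pi\<^sub>M {0..<t} (\<lambda>_. round_space) \<rightarrow>\<^sub>M Pi\<^sub>M UNIV (\<lambda>_. unit_borel)"
proof (rule measurable_PiM_single')
  fix i
  have "(\<lambda>\<omega>. emp_mean \<omega> t i) \<in> borel_measurable (Pi\<^sub>M {0..<t} (\<lambda>_. round_space))"
    unfolding emp_mean_def reward_sum_eq
    by (intro borel_measurable_divide borel_measurable_sum measurable_If borel_measurable_add
        measurable_compose[OF measurable_pulls] pred_fst_round[unfolded pred_def] measurable_snd_round) auto
  then show "(\<lambda>\<omega>. emp_mean \<omega> t i) \<in> Pi\<^sub>M {0..<t} (\<lambda>_. round_space) \<rightarrow>\<^sub>M unit_borel"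
    by (intro measurable_restrict_space2) (auto dest: emp_mean_bounds)
qed (auto simp: space_restrict_space PiE_iff dest: emp_mean_bounds[simplified])

lemma Ionescu_Tulcea_round_law:
  fixes \<Theta> :: "'n::finite bandit"
  assumes "\<Theta> \<in> instances" and "markov_policy Q"
  shows "Ionescu_Tulcea (round_law \<Theta> Q) (\<lambda>_. round_space)"
proof (rule Ionescu_Tulcea.intro)
  fix t
  let ?H = "Pi\<^sub>M {0..<t} (\<lambda>_. round_space) :: (nat \<Rightarrow> 'n \<times> real) measure"
  let ?q = "\<lambda>\<omega>. Q (pulls \<omega> t) (emp_mean \<omega> t)"
  have \<Theta>: "prob_space (\<Theta> i)" "sets (\<Theta> i) = sets unit_borel" for i
    using assms(1) by (auto simp: instances_def)
  have reward: "prob_space (distr (\<Theta> i) round_space (Pair i))" for i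
    by (intro prob_space.prob_space_distr \<Theta> measurable_Pair_round_space)
  then have reward_kernel: "(\<lambda>i. distr (\<Theta> i) round_space (Pair i))
      \<in> count_space UNIV \<rightarrow>\<^sub>M subprob_algebra round_space"
    by (auto simp: space_subprob_algebra prob_space_imp_subprob_space)
  have "(\<lambda>\<omega>. pulls \<omega> t) \<in> ?H \<rightarrow>\<^sub>M count_space UNIV"
  proof (subst measurable_count_space_eq_countable, safe)
    fix \<kappa> :: "'n \<Rightarrow> nat"
    have "(\<lambda>\<omega>. pulls \<omega> t) -` {\<kappa>} \<inter> space ?H = {\<omega>\<in>space ?H. \<forall>i. pulls \<omega> t i = \<kappa> i}"
      by auto
    also have "\<dots> \<in> sets ?H"
      by (intro sets.sets_Collect measurable_sets_Collect[OF measurable_pulls]) auto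
    finally show "(\<lambda>\<omega>. pulls \<omega> t) -` {\<kappa>} \<inter> space ?H \<in> sets ?H" .
  qed auto
  then have pmf: "(\<lambda>\<omega>. pmf (?q \<omega>) i) \<in> borel_measurable ?H" for i
  proof (rule measurable_compose_countable[rotated])
    fix \<kappa>
    have "(\<lambda>u. pmf (Q \<kappa> u) i) \<in> borel_measurable (Pi\<^sub>M UNIV (\<lambda>_. unit_borel))"
      using assms(2) unfolding markov_policy_def by blast
    then show "(\<lambda>\<omega>. pmf (Q \<kappa> (emp_mean \<omega> t)) i) \<in> borel_measurable ?H"
      by (rule measurable_compose[OF measurable_emp_mean])
  qed
  have arm_kernel: "(\<lambda>\<omega>. measure_pmf (?q \<omega>)) \<in> ?H \<rightarrow>\<^sub>M subprob_algebra (count_space UNIV)"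
  proof (rule measurable_subprob_algebra)
    fix A :: "'n set"
    show "(\<lambda>\<omega>. emeasure (measure_pmf (?q \<omega>)) A) \<in> borel_measurable ?H"
      using pmf by (subst emeasure_measure_pmf_finite) auto
  qed (auto intro: prob_space_imp_subprob_space measure_pmf.prob_space_axioms)
  show "round_law \<Theta> Q t \<in> ?H \<rightarrow>\<^sub>M subprob_algebra round_space"
    unfolding round_law_def by (rule measurable_bind2[OF arm_kernel reward_kernel])
  show "prob_space (round_law \<Theta> Q t \<omega>)" if "\<omega> \<in> space ?H" for \<omega>
    unfolding round_law_def
    by (rule measure_pmf.prob_space_bind[where S = round_space])
      (use reward measurable_space[OF reward_kernel] in auto)
qed


section \<open>Regret\<close>

definition pseudo_regret :: "'n::finite bandit \<Rightarrow> nat \<Rightarrow> (nat \<Rightarrow> 'n \<times> real) \<Rightarrow> real" where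
  "pseudo_regret \<Theta> T \<omega> = (\<Sum>t<T. opt_mean \<Theta> - mean \<Theta> (fst (\<omega> t)))"

definition regret :: "'n::finite bandit \<Rightarrow> 'n policy \<Rightarrow> nat \<Rightarrow> real" where
  "regret \<Theta> Q T = opt_mean \<Theta> * real T - (\<integral>\<omega>. (\<Sum>t<T. snd (\<omega> t)) \<partial>trajectory_law \<Theta> Q)"

definition worst_case_regret :: "'n::finite policy \<Rightarrow> nat \<Rightarrow> real" where
  "worst_case_regret Q T = (SUP \<Theta>\<in>instances. regret \<Theta> Q T)"

end

(* Let arm 1 be Bernoulli(3/4) and arm 2 constantly 1/2, and put L = (log T)^s with s < 1, m = ceil L.
   Consider the event that the first m rounds pull arm 2 and that afterwards each of the at most m
   pulls of arm 1 yields 0. As long as it persists, arm 1 never looks better than arm 2. Hence each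
   of the first m rounds costs a factor 1/2 (unradical); each of the first m pulls of arm 1 costs a
   factor 1/4; and once both arms have been pulled m times, each further round costs a factor
   1 - L/T (irreversible). So the event has probability at least 8^(-m) (1 - L/T)^T >= exp (-8 L) =
   T^(-o(1)), and on it arm 2 is pulled in all but m rounds. The product bound is made rigorous by
   the submartingale "weight", the indicator of the event so far times the price still to be paid. *)

theory Submission
  imports Defs "HOL-Real_Asymp.Real_Asymp"
begin

section \<open>One round of the process\<close>

text \<open>\<open>round_law\<close> mixes, over the arms, pushforwards along \<open>Pair i\<close>:
  the bind is integrated first, each pushforward next, and finitely many arms turn the outer
  integral into a sum.\<close>

lemma nn_integral_round_law:
  fixes \<Theta> :: "'n::finite bandit"
  assumes "\<Theta> \<in> instances" and g: "g \<in> borel_measurable round_space"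
  shows "(\<integral>\<^sup>+y. g y \<partial>round_law \<Theta> Q t \<omega>) =
    (\<Sum>i\<in>UNIV. ennreal (pmf (Q (pulls \<omega> t) (emp_mean \<omega> t)) i) * (\<integral>\<^sup>+x. g (i, x) \<partial>\<Theta> i))"
proof -
  have \<Theta>: "prob_space (\<Theta> i)" "sets (\<Theta> i) = sets unit_borel" for i
    using assms(1) by (auto simp: instances_def)
  have "prob_space (distr (\<Theta> i) round_space (Pair i))" for i
    by (intro prob_space.prob_space_distr \<Theta> measurable_Pair_round_space)
  then have "(\<lambda>i. distr (\<Theta> i) round_space (Pair i))
      \<in> count_space UNIV \<rightarrow>\<^sub>M subprob_algebra round_space"
    by (auto simp: space_subprob_algebra prob_space_imp_subprob_space)
  then have "(\<integral>\<^sup>+y. g y \<partial>round_law \<Theta> Q t \<omega>) =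
      (\<integral>\<^sup>+i. (\<integral>\<^sup>+y. g y \<partial>distr (\<Theta> i) round_space (Pair i))
        \<partial>measure_pmf (Q (pulls \<omega> t) (emp_mean \<omega> t)))"
    unfolding round_law_def by (intro nn_integral_bind[OF g]) auto
  also have "\<dots> = (\<integral>\<^sup>+i. (\<integral>\<^sup>+x. g (i, x) \<partial>\<Theta> i)
        \<partial>measure_pmf (Q (pulls \<omega> t) (emp_mean \<omega> t)))"
    by (intro nn_integral_cong nn_integral_distr measurable_Pair_round_space \<Theta>) (simp add: g)
  finally show ?thesis
    by (simp add: nn_integral_measure_pmf nn_integral_count_space_finite)
qed

section \<open>Finite marginals of the trajectory law, and conditioning on the last round\<close>

lemma pulls_restrict: "t \<le> n \<Longrightarrow> pulls (restrict \<omega> {0..<n}) t = pulls \<omega> t"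
  by (auto simp: pulls_eq_sum fun_eq_iff)

lemma emp_mean_restrict: "t \<le> n \<Longrightarrow> emp_mean (restrict \<omega> {0..<n}) t = emp_mean \<omega> t"
  unfolding emp_mean_def[abs_def] reward_sum_eq pulls_restrict
  by (intro ext arg_cong2[where f="(/)"] sum.cong) auto

context
  fixes \<Theta> :: "'n::finite bandit" and Q :: "'n policy"
  assumes \<Theta>: "\<Theta> \<in> instances" and Q: "markov_policy Q"
begin

interpretation IT: Ionescu_Tulcea "round_law \<Theta> Q" "\<lambda>_. round_space"
  by (rule Ionescu_Tulcea_round_law[OF \<Theta> Q])

lemma sets_trajectory_law: "sets (trajectory_law \<Theta> Q) = sets (Pi\<^sub>M UNIV (\<lambda>_. round_space))"
  unfolding trajectory_law_def by simp

lemma space_trajectory_law: "space (trajectory_law \<Theta> Q) = {\<omega>. \<forall>t. snd (\<omega> t) \<in> {0..1}}"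
  unfolding trajectory_law_def by (auto simp: space_PiM space_round_space PiE_iff mem_Times_iff)

lemma measurable_restrict_trajectory:
  "(\<lambda>\<omega>. restrict \<omega> {0..<n}) \<in> trajectory_law \<Theta> Q \<rightarrow>\<^sub>M Pi\<^sub>M {0..<n} (\<lambda>_. round_space)"
  unfolding measurable_cong_sets[OF sets_trajectory_law refl]
  by (rule measurable_restrict_subset) auto

text \<open>Ties the projective limit to the explicit composition of the first \<open>n\<close>
  kernels, where one round can be split off. The start \<open>\<lambda>_. undefined\<close> is the
  only history of length 0, the unique point of the product over no coordinates.\<close>

lemma distr_trajectory_law:
  "distr (trajectory_law \<Theta> Q) (Pi\<^sub>M {0..<n} (\<lambda>_. round_space)) (\<lambda>\<omega>. restrict \<omega> {0..<n})
    = IT.C 0 n (\<lambda>_. undefined)"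
proof (rule measure_eqI)
  fix A assume "A \<in> sets (distr (trajectory_law \<Theta> Q) (Pi\<^sub>M {0..<n} (\<lambda>_. round_space)) (\<lambda>\<omega>. restrict \<omega> {0..<n}))"
  then have A: "A \<in> sets (Pi\<^sub>M {0..<n} (\<lambda>_. round_space))" by simp
  have "emeasure (distr (trajectory_law \<Theta> Q) (Pi\<^sub>M {0..<n} (\<lambda>_. round_space)) (\<lambda>\<omega>. restrict \<omega> {0..<n})) A
      = emeasure IT.PF.lim (IT.PF.emb UNIV {0..<n} A)"
    unfolding trajectory_law_def
    by (rule emeasure_distr_restrict) (use A in auto)
  also have "\<dots> = emeasure (IT.CI {0..<n}) A"
    using A by (intro IT.lim) auto
  also have "\<dots> = emeasure (IT.C 0 n (\<lambda>_. undefined)) (IT.PF.emb {0..<n} {0..<n} A)"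
    using A by (intro IT.emeasure_CI) auto
  also have "IT.PF.emb {0..<n} {0..<n} A = A"
    using sets.sets_into_space[OF A] by (intro prod_emb_id) (simp add: space_PiM)
  finally show "emeasure (distr (trajectory_law \<Theta> Q) (Pi\<^sub>M {0..<n} (\<lambda>_. round_space)) (\<lambda>\<omega>. restrict \<omega> {0..<n})) A
      = emeasure (IT.C 0 n (\<lambda>_. undefined)) A" .
qed (simp add: IT.sets_C)

text \<open>The tower property: condition on the first \<open>n\<close> rounds and integrate round
  \<open>n\<close> against its kernel. Both the formula for the regret and the growth of
  \<open>weight\<close> in expectation are derived from it.\<close>

lemma nn_integral_trajectory_Suc:
  assumes f: "f \<in> borel_measurable (Pi\<^sub>M {0..<Suc n} (\<lambda>_. round_space))"
  shows "(\<integral>\<^sup>+\<omega>. f (restrict \<omega> {0..<Suc n}) \<partial>trajectory_law \<Theta> Q) =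
    (\<integral>\<^sup>+\<omega>. (\<Sum>i\<in>UNIV. ennreal (pmf (Q (pulls \<omega> n) (emp_mean \<omega> n)) i) *
        (\<integral>\<^sup>+x. f (fun_upd (restrict \<omega> {0..<n}) n (i, x)) \<partial>\<Theta> i)) \<partial>trajectory_law \<Theta> Q)"
proof -
  let ?P = "\<lambda>n. Pi\<^sub>M {0..<n} (\<lambda>_. round_space) :: (nat \<Rightarrow> 'n \<times> real) measure"
  let ?C = "\<lambda>n. IT.C 0 n (\<lambda>_. undefined)"
  define F where "F = (\<lambda>\<omega>. \<integral>\<^sup>+x. f x \<partial>IT.eP n \<omega>)"
  have F: "F \<in> borel_measurable (?P n)"
    unfolding F_def by (rule measurable_compose[OF IT.measurable_eP nn_integral_measurable_subprob_algebra[OF f]])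
  have F_eq: "F \<omega> = (\<Sum>i\<in>UNIV. ennreal (pmf (Q (pulls \<omega> n) (emp_mean \<omega> n)) i) *
        (\<integral>\<^sup>+x. f (fun_upd \<omega> n (i, x)) \<partial>\<Theta> i))" if \<omega>: "\<omega> \<in> space (?P n)" for \<omega>
  proof -
    have "(\<lambda>y. fun_upd \<omega> n y) \<in> round_space \<rightarrow>\<^sub>M ?P (Suc n)"
      using \<omega> by (intro measurable_fun_upd[where J="{0..<n}"]) auto
    from measurable_compose[OF this f]
    show ?thesis unfolding F_def IT.nn_integral_eP[OF \<omega> f]
      by (rule nn_integral_round_law[OF \<Theta>])
  qed
  have "(\<integral>\<^sup>+\<omega>. f (restrict \<omega> {0..<Suc n}) \<partial>trajectory_law \<Theta> Q) = (\<integral>\<^sup>+\<omega>. f \<omega> \<partial>?C (Suc n))"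
    unfolding distr_trajectory_law[symmetric]
    by (subst nn_integral_distr[OF measurable_restrict_trajectory]) (simp_all add: f)
  \<comment> \<open>Composition up to \<open>Suc n\<close> is composition up to \<open>n\<close>
    followed by a bind with \<open>IT.eP n\<close>.\<close>
  also have "\<dots> = (\<integral>\<^sup>+\<omega>. F \<omega> \<partial>?C n)"
    unfolding F_def using IT.measurable_eP[of n] 
    by (simp add: nn_integral_bind[OF f] measurable_cong_sets[OF IT.sets_C refl])
  also have "\<dots> = (\<integral>\<^sup>+\<omega>. F (restrict \<omega> {0..<n}) \<partial>trajectory_law \<Theta> Q)"
    unfolding distr_trajectory_law[symmetric]
    by (subst nn_integral_distr[OF measurable_restrict_trajectory]) (simp_all add: F)
  also have "\<dots> = (\<integral>\<^sup>+\<omega>. (\<Sum>i\<in>UNIV. ennreal (pmf (Q (pulls \<omega> n) (emp_mean \<omega> n)) i) *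
        (\<integral>\<^sup>+x. f (fun_upd (restrict \<omega> {0..<n}) n (i, x)) \<partial>\<Theta> i)) \<partial>trajectory_law \<Theta> Q)"
    by (intro nn_integral_cong)
      (simp add: F_eq[OF measurable_space[OF measurable_restrict_trajectory]] pulls_restrict emp_mean_restrict)
  finally show ?thesis .
qed

lemma prob_space_trajectory_law: "prob_space (trajectory_law \<Theta> Q)"
proof (rule prob_space_distrD[OF measurable_restrict_trajectory[of 0]])
  show "prob_space (distr (trajectory_law \<Theta> Q) (Pi\<^sub>M {0..<0} (\<lambda>_. round_space)) (\<lambda>\<omega>. restrict \<omega> {0..<0}))"
    unfolding distr_trajectory_law by (intro IT.prob_space_C) simp
qed

end

section \<open>Regret and pseudo-regret\<close>

lemma mean_bounds:
  assumes "\<Theta> \<in> instances"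
  shows "mean \<Theta> i \<in> {0..1}" "mean \<Theta> i \<le> opt_mean \<Theta>" "opt_mean \<Theta> \<in> {0..1}"
    and "(\<integral>\<^sup>+x. ennreal x \<partial>\<Theta> i) = ennreal (mean \<Theta> i)"
proof -
  have *: "mean \<Theta> i \<in> {0..1} \<and> (\<integral>\<^sup>+x. ennreal x \<partial>\<Theta> i) = ennreal (mean \<Theta> i)" for i
  proof -
    have s: "sets (\<Theta> i) = sets unit_borel" using assms by (auto simp: instances_def)
    interpret prob_space "\<Theta> i" using assms by (auto simp: instances_def)
    have sp: "space (\<Theta> i) = {0..1}" using sets_eq_imp_space_eq[OF s] by (simp add: space_restrict_space)
    have m: "(\<lambda>x. x) \<in> borel_measurable (\<Theta> i)"
      unfolding measurable_cong_sets[OF s refl] by (rule measurable_restrict_space1) simp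
    have b: "AE x in \<Theta> i. 0 \<le> x" "AE x in \<Theta> i. x \<le> 1" by (auto intro!: AE_I2 simp: sp)
    have i: "integrable (\<Theta> i) (\<lambda>x. x)"
      by (rule integrable_const_bound[of _ 1]) (auto intro!: AE_I2 m simp: sp)
    show ?thesis unfolding mean_def
      using integral_nonneg_AE[OF b(1)] integral_le_const[OF i b(2)] nn_integral_eq_integral[OF i b(1)]
      by simp
  qed
  then show "mean \<Theta> i \<in> {0..1}" "(\<integral>\<^sup>+x. ennreal x \<partial>\<Theta> i) = ennreal (mean \<Theta> i)" by auto
  show "mean \<Theta> i \<le> opt_mean \<Theta>" by (simp add: opt_mean_def)
  have "opt_mean \<Theta> \<in> range (mean \<Theta>)" unfolding opt_mean_def by (rule Max_in) auto
  with * show "opt_mean \<Theta> \<in> {0..1}" by auto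
qed

context
  fixes \<Theta> :: "'n::finite bandit" and Q :: "'n policy"
  assumes \<Theta>: "\<Theta> \<in> instances" and Q: "markov_policy Q"
begin

interpretation prob_space "trajectory_law \<Theta> Q"
  by (rule prob_space_trajectory_law[OF \<Theta> Q])

lemma measurable_trajectory:
  "(\<lambda>\<omega>. fst (\<omega> t)) \<in> trajectory_law \<Theta> Q \<rightarrow>\<^sub>M count_space UNIV"
  "(\<lambda>\<omega>. snd (\<omega> t)) \<in> borel_measurable (trajectory_law \<Theta> Q)"
  using measurable_compose[OF measurable_restrict_trajectory[OF \<Theta> Q] measurable_fst_round[of t "Suc t"]]
    measurable_compose[OF measurable_restrict_trajectory[OF \<Theta> Q] measurable_snd_round[of t "Suc t"]]
  by simp_all

lemma integrable_trajectory:
  "integrable (trajectory_law \<Theta> Q) (\<lambda>\<omega>. snd (\<omega> t))"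
  "integrable (trajectory_law \<Theta> Q) (\<lambda>\<omega>. mean \<Theta> (fst (\<omega> t)))"
  using mean_bounds(1)[OF \<Theta>] measurable_compose[OF measurable_trajectory(1)[of t], of "mean \<Theta>" borel]
  by (auto intro!: integrable_const_bound[of _ 1] AE_I2 measurable_trajectory simp: space_trajectory_law[OF \<Theta> Q])

text \<open>Given the past, either integrand averages to the sum over the arms of pulling
  probability times mean, so the tower property applied to both sides gives the same integral.
  Nonnegativity permits the detour through \<open>ennreal\<close>.\<close>

lemma integral_reward:
  "(\<integral>\<omega>. snd (\<omega> t) \<partial>trajectory_law \<Theta> Q) = (\<integral>\<omega>. mean \<Theta> (fst (\<omega> t)) \<partial>trajectory_law \<Theta> Q)"
proof -
  have "(\<integral>\<^sup>+\<omega>. ennreal (snd (\<omega> t)) \<partial>trajectory_law \<Theta> Q) =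
      (\<integral>\<^sup>+\<omega>. ennreal (mean \<Theta> (fst (\<omega> t))) \<partial>trajectory_law \<Theta> Q)"
    using nn_integral_trajectory_Suc[OF \<Theta> Q, where n=t and f="\<lambda>\<omega>. ennreal (snd (\<omega> t))"]
      nn_integral_trajectory_Suc[OF \<Theta> Q, where n=t and f="\<lambda>\<omega>. ennreal (mean \<Theta> (fst (\<omega> t)))"]
      measurable_compose[OF measurable_snd_round[of t "Suc t"] measurable_ennreal]
      measurable_compose[OF measurable_fst_round[of t "Suc t"], of "\<lambda>i. ennreal (mean \<Theta> i)" borel]
      mean_bounds(4)[OF \<Theta>] \<Theta>
    by (simp add: prob_space.emeasure_space_1 instances_def)
  then show ?thesis
    using mean_bounds(1)[OF \<Theta>] integrable_trajectory
    by (subst (1 2) integral_eq_nn_integral) (auto intro!: AE_I2 simp: space_trajectory_law[OF \<Theta> Q])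
qed

lemma integrable_pseudo_regret: "integrable (trajectory_law \<Theta> Q) (pseudo_regret \<Theta> T)"
  unfolding pseudo_regret_def[abs_def] using integrable_trajectory by auto

lemma regret_eq: "regret \<Theta> Q T = (\<integral>\<omega>. pseudo_regret \<Theta> T \<omega> \<partial>trajectory_law \<Theta> Q)"
  unfolding regret_def pseudo_regret_def using integrable_trajectory
  by (simp add: Bochner_Integration.integral_sum integral_reward sum_subtractf prob_space)

lemma pseudo_regret_nonneg: "pseudo_regret \<Theta> T \<omega> \<ge> 0"
  using mean_bounds(2)[OF \<Theta>] by (auto simp: pseudo_regret_def intro!: sum_nonneg)

text \<open>Markov's inequality for the nonnegative pseudo-regret, whose expectation is the
  regret.\<close>

lemma regret_ge_prob:
  assumes "c > 0"
  shows "c * measure (trajectory_law \<Theta> Q) {\<omega> \<in> space (trajectory_law \<Theta> Q). pseudo_regret \<Theta> T \<omega> \<ge> c}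
    \<le> regret \<Theta> Q T"
  using integral_Markov_inequality_measure[OF integrable_pseudo_regret[of T], where A="{}" and c=c] assms
  by (simp add: regret_eq pseudo_regret_nonneg divide_simps mult.commute)

text \<open>A bound uniform in the instance: a real-valued \<open>SUP\<close> is known to dominate
  its members only over a set that is bounded above.\<close>

lemma regret_le: "regret \<Theta> Q T \<le> real T"
proof -
  have "(\<integral>\<omega>. (\<Sum>t<T. snd (\<omega> t)) \<partial>trajectory_law \<Theta> Q) \<ge> 0"
    by (intro integral_nonneg_AE AE_I2 sum_nonneg) (auto simp: space_trajectory_law[OF \<Theta> Q])
  moreover have "opt_mean \<Theta> * real T \<le> real T"
    using mean_bounds(3)[OF \<Theta>] by (auto intro: mult_left_le_one_le)
  ultimately show ?thesis by (simp add: regret_def)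
qed

end

lemma regret_le_worst_case:
  assumes "\<Theta> \<in> instances" "markov_policy Q"
  shows "regret \<Theta> Q T \<le> worst_case_regret Q T"
  unfolding worst_case_regret_def
  using assms regret_le[OF _ assms(2)] by (intro cSUP_upper) (auto intro!: bdd_aboveI2)

section \<open>The hard instance\<close>

text \<open>Reward laws must live on \<open>unit_borel\<close>, so the Bernoulli law is pushed
  forward by \<open>of_bool\<close>. The optimal arm can show 0 with constant probability, while the
  rewards of the other arm carry no randomness.\<close>

definition hard_instance :: "2 bandit" where
  "hard_instance i = (if i = 1 then distr (measure_pmf (bernoulli_pmf (3/4))) unit_borel of_bool
    else return unit_borel (1/2))"

lemma of_bool_measurable_unit_borel: "of_bool \<in> measure_pmf p \<rightarrow>\<^sub>M unit_borel"
  by (auto intro!: measurable_restrict_space2 simp: space_restrict_space)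

lemma nn_integral_hard_instance:
  assumes "g \<in> borel_measurable unit_borel"
  shows "(\<integral>\<^sup>+x. g x \<partial>hard_instance 1) = ennreal (3/4) * g 1 + ennreal (1/4) * g 0"
    and "(\<integral>\<^sup>+x. g x \<partial>hard_instance 2) = g (1/2)"
proof -
  show "(\<integral>\<^sup>+x. g x \<partial>hard_instance 1) = ennreal (3/4) * g 1 + ennreal (1/4) * g 0"
    using assms nn_integral_distr[OF of_bool_measurable_unit_borel, of g "bernoulli_pmf (3/4)"]
    by (simp add: hard_instance_def mult.commute)
  show "(\<integral>\<^sup>+x. g x \<partial>hard_instance 2) = g (1/2)"
    using assms by (simp add: hard_instance_def nn_integral_return space_restrict_space)
qed

lemma mean_hard_instance: "mean hard_instance i = (if i = 1 then 3/4 else 1/2)"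
proof -
  have id: "(\<lambda>x. x) \<in> borel_measurable unit_borel"
    by (rule measurable_restrict_space1) simp
  show ?thesis
    using integral_distr[OF of_bool_measurable_unit_borel id, of "bernoulli_pmf (3/4)"]
      integral_return[OF _ id, of "1/2"]
    by (auto simp: mean_def hard_instance_def space_restrict_space)
qed

lemma opt_mean_hard_instance: "opt_mean hard_instance = 3/4"
proof -
  have "range (mean hard_instance) = {3/4, 1/2}"
    by (auto simp: mean_hard_instance UNIV_2)
  then show ?thesis by (simp add: opt_mean_def)
qed

lemma hard_instance_in_instances: "hard_instance \<in> instances"
proof -
  have "prob_space (hard_instance i) \<and> sets (hard_instance i) = sets unit_borel" for i
    by (auto simp: hard_instance_def space_restrict_space
        intro!: prob_space_return prob_space.prob_space_distr[OF _ of_bool_measurable_unit_borel]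
          measure_pmf.prob_space_axioms)
  moreover have "\<exists>!i. mean hard_instance i = opt_mean hard_instance"
    by (rule ex1I[of _ 1]) (auto simp: mean_hard_instance opt_mean_hard_instance split: if_splits)
  ultimately show ?thesis by (simp add: instances_def)
qed

lemma pseudo_regret_hard_instance: "pseudo_regret hard_instance T \<omega> = real (pulls \<omega> T 2) / 4"
proof -
  have "opt_mean hard_instance - mean hard_instance i = (if i = 2 then 1/4 else 0)" for i
    using exhaust_2[of i] by (auto simp: mean_hard_instance opt_mean_hard_instance)
  then show ?thesis
    by (simp add: pseudo_regret_def pulls_eq_sum sum_divide_distrib if_distrib[of real]
        if_distrib[of "\<lambda>x. x / 4"] cong: if_cong)
qed

section \<open>The unlucky event\<close>

text \<open>Rewards are prescribed together with arms, so that the empirical means become functions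
  of the pull counts. Under \<open>hard_instance\<close> the reward 1/2 of arm 2 is almost sure;
  requiring it pointwise avoids arguing modulo null sets. Time starts at 0, so \<open>t < m\<close>
  covers exactly the first \<open>m\<close> rounds.\<close>

definition unlucky :: "nat \<Rightarrow> nat \<Rightarrow> (nat \<Rightarrow> 2 \<times> real) \<Rightarrow> bool" where
  "unlucky m n \<omega> \<longleftrightarrow> (\<forall>t<n. \<omega> t = (2, 1/2) \<or> m \<le> t \<and> pulls \<omega> t 1 < m \<and> \<omega> t = (1, 0))"

lemma unlucky_Suc:
  "unlucky m (Suc n) \<omega> \<longleftrightarrow>
    unlucky m n \<omega> \<and> (\<omega> n = (2, 1/2) \<or> m \<le> n \<and> pulls \<omega> n 1 < m \<and> \<omega> n = (1, 0))"
  by (auto simp: unlucky_def less_Suc_eq)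

lemma pulls_Suc: "pulls \<omega> (Suc n) i = pulls \<omega> n i + (if fst (\<omega> n) = i then 1 else 0)"
  by (simp add: pulls_eq_sum)

lemma pulls_cong: "(\<And>l. l < n \<Longrightarrow> \<omega> l = \<omega>' l) \<Longrightarrow> pulls \<omega> n = pulls \<omega>' n"
  by (auto simp: pulls_eq_sum fun_eq_iff)

lemma unlucky_cong:
  assumes "\<And>l. l < n \<Longrightarrow> \<omega> l = \<omega>' l"
  shows "unlucky m n \<omega> = unlucky m n \<omega>'"
proof -
  have "\<omega> t = \<omega>' t \<and> pulls \<omega> t 1 = pulls \<omega>' t 1" if "t < n" for t
  proof
    show "\<omega> t = \<omega>' t" using that by (rule assms)
    have "pulls \<omega> t = pulls \<omega>' t" by (rule pulls_cong) (use that assms in auto)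
    then show "pulls \<omega> t 1 = pulls \<omega>' t 1" by simp
  qed
  then show ?thesis unfolding unlucky_def by auto
qed

text \<open>Induction on \<open>n\<close>: arm 1 has collected only zeros and arm 2 only halves. The
  bound by \<open>min n m\<close> records that the first \<open>m\<close> rounds all pull arm 2. The
  extra 1 in the denominator of \<open>emp_mean\<close> keeps arm 2 below 1/2.\<close>

lemma unlucky_state:
  assumes "unlucky m n \<omega>"
  shows "emp_mean \<omega> n 1 = 0" "emp_mean \<omega> n 2 = real (pulls \<omega> n 2) / (2 * (real (pulls \<omega> n 2) + 1))"
    and "pulls \<omega> n 1 \<le> m" "min n m \<le> pulls \<omega> n 2" "pulls \<omega> n 1 + pulls \<omega> n 2 = n"
proof -
  have "(\<Sum>l<n. if fst (\<omega> l) = 1 then snd (\<omega> l) else 0) = 0 \<and>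
      (\<Sum>l<n. if fst (\<omega> l) = 2 then snd (\<omega> l) else 0) = real (pulls \<omega> n 2) / 2 \<and>
      pulls \<omega> n 1 \<le> m \<and> min n m \<le> pulls \<omega> n 2 \<and> pulls \<omega> n 1 + pulls \<omega> n 2 = n"
    using assms
  proof (induction n)
    case (Suc n)
    then show ?case by (auto simp: unlucky_Suc pulls_Suc add_divide_distrib)
  qed (simp add: pulls_eq_sum)
  then have 1: "(\<Sum>l<n. if fst (\<omega> l) = 1 then snd (\<omega> l) else 0) = 0"
    and 2: "(\<Sum>l<n. if fst (\<omega> l) = 2 then snd (\<omega> l) else 0) = real (pulls \<omega> n 2) / 2"
    and 3: "pulls \<omega> n 1 \<le> m" "min n m \<le> pulls \<omega> n 2" "pulls \<omega> n 1 + pulls \<omega> n 2 = n"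
    by blast+
  show "emp_mean \<omega> n 1 = 0" "emp_mean \<omega> n 2 = real (pulls \<omega> n 2) / (2 * (real (pulls \<omega> n 2) + 1))"
    unfolding emp_mean_def reward_sum_eq 1 2 by simp_all
  show "pulls \<omega> n 1 \<le> m" "min n m \<le> pulls \<omega> n 2" "pulls \<omega> n 1 + pulls \<omega> n 2 = n"
    by (fact 3)+
qed

lemma unlucky_emp_mean_cube:
  assumes "unlucky m n \<omega>"
  shows "emp_mean \<omega> n \<in> cube"
proof -
  have "emp_mean \<omega> n i \<in> {0..1}" for i
    using exhaust_2[of i] by (elim disjE) (simp_all add: unlucky_state(1,2)[OF assms] divide_simps)
  then show ?thesis by (auto simp: cube_def)
qed

section \<open>Measurability of the unlucky event, and the weight attached to it\<close>

lemma measurable_pulls_le: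
  "t \<le> n \<Longrightarrow> (\<lambda>\<omega>. pulls \<omega> t i) \<in> Pi\<^sub>M {0..<n} (\<lambda>_. round_space) \<rightarrow>\<^sub>M count_space UNIV"
  unfolding pulls_eq_sum by (intro measurable_sum_nat measurable_If pred_fst_round[unfolded pred_def]) auto

lemma pred_unlucky: "Measurable.pred (Pi\<^sub>M {0..<n} (\<lambda>_. round_space)) (unlucky m n)"
proof -
  have [measurable]: "Measurable.pred (Pi\<^sub>M {0..<n} (\<lambda>_. round_space)) (\<lambda>\<omega>. fst (\<omega> t) = (i :: 2))"
    "(\<lambda>\<omega>. pulls \<omega> t (1::2)) \<in> Pi\<^sub>M {0..<n} (\<lambda>_. round_space) \<rightarrow>\<^sub>M count_space UNIV"
    "(\<lambda>\<omega>. snd (\<omega> t)) \<in> borel_measurable (Pi\<^sub>M {0..<n} (\<lambda>_. round_space :: (2 \<times> real) measure))" if "t < n" for t i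
    using that by (auto intro!: pred_fst_round measurable_snd_round measurable_pulls_le)
  have "Measurable.pred (Pi\<^sub>M {0..<n} (\<lambda>_. round_space)) (\<lambda>\<omega>. \<forall>t\<in>{..<n}. 
      (fst (\<omega> t) = (2::2) \<and> snd (\<omega> t) = 1/2) \<or> m \<le> t \<and> pulls \<omega> t 1 < m \<and> (fst (\<omega> t) = 1 \<and> snd (\<omega> t) = 0))"
    by (intro pred_intros_finite) (auto intro!: pred_intros_logic)
  then show ?thesis by (simp add: unlucky_def[abs_def] prod_eq_iff Ball_def)
qed

text \<open>The power factors are the price still to be paid: 1/2 per outstanding initial round, 1/4
  per outstanding pull of arm 1, \<open>1 - \<rho>\<close> per outstanding round up to
  \<open>T\<close>. Subtraction on naturals truncates at 0, so a completed phase contributes the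
  factor 1.\<close>

definition weight :: "nat \<Rightarrow> real \<Rightarrow> nat \<Rightarrow> nat \<Rightarrow> (nat \<Rightarrow> 2 \<times> real) \<Rightarrow> real" where
  "weight m \<rho> T n \<omega> = of_bool (unlucky m n \<omega>) *
     ((1/2) ^ (m - n) * (1/4) ^ (m - pulls \<omega> n 1) * (1 - \<rho>) ^ (T - n))"

lemma weight_measurable: "weight m \<rho> T n \<in> borel_measurable (Pi\<^sub>M {0..<n} (\<lambda>_. round_space))"
proof -
  have "(\<lambda>\<omega>. (1/2) ^ (m - n) * (1/4) ^ (m - pulls \<omega> n 1) * (1 - \<rho>) ^ (T - n))
      \<in> borel_measurable (Pi\<^sub>M {0..<n} (\<lambda>_. round_space :: (2 \<times> real) measure))"
    by (rule measurable_compose[OF measurable_pulls]) simp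
  then have "(\<lambda>\<omega>. if unlucky m n \<omega> then (1/2) ^ (m - n) * (1/4) ^ (m - pulls \<omega> n 1) * (1 - \<rho>) ^ (T - n) else 0)
      \<in> borel_measurable (Pi\<^sub>M {0..<n} (\<lambda>_. round_space))"
    by (intro measurable_If pred_unlucky[unfolded pred_def]) simp_all
  also have "?this \<longleftrightarrow> ?thesis"
    by (rule arg_cong[where f="\<lambda>f. f \<in> _"]) (simp add: weight_def fun_eq_iff)
  finally show ?thesis .
qed

lemma weight_cong:
  assumes "\<And>l. l < n \<Longrightarrow> \<omega> l = \<omega>' l"
  shows "weight m \<rho> T n \<omega> = weight m \<rho> T n \<omega>'"
proof -
  have 1: "pulls \<omega> n = pulls \<omega>' n" by (rule pulls_cong) (rule assms)
  have 2: "unlucky m n \<omega> = unlucky m n \<omega>'" by (rule unlucky_cong) (rule assms)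
  show ?thesis unfolding weight_def 1 2 ..
qed

lemma weight_nonneg: "\<rho> \<le> 1 \<Longrightarrow> 0 \<le> weight m \<rho> T n \<omega>"
  by (simp add: weight_def)

text \<open>Expresses the next weight through the past state and the new pair alone, so that the
  one-step inequality can be checked case by case.\<close>

lemma weight_upd:
  "weight m \<rho> T (Suc n) (fun_upd \<omega> n (i, x)) =
    of_bool (unlucky m n \<omega> \<and> ((i, x) = (2, 1/2) \<or> m \<le> n \<and> pulls \<omega> n 1 < m \<and> (i, x) = (1, 0))) *
     ((1/2) ^ (m - Suc n) * (1/4) ^ (m - (pulls \<omega> n 1 + (if i = 1 then 1 else 0))) * (1 - \<rho>) ^ (T - Suc n))"
proof -
  have 1: "pulls (fun_upd \<omega> n (i, x)) n = pulls \<omega> n"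
    by (rule pulls_cong) simp
  have 2: "unlucky m n (fun_upd \<omega> n (i, x)) = unlucky m n \<omega>"
    by (rule unlucky_cong) simp
  show ?thesis
    unfolding weight_def unlucky_Suc pulls_Suc 1 2 fun_upd_same fst_conv ..
qed

section \<open>The one-step submartingale inequality\<close>

definition separated_bound :: "2 policy \<Rightarrow> nat \<Rightarrow> real \<Rightarrow> bool" where
  "separated_bound Q m \<rho> \<longleftrightarrow> (\<forall>\<kappa>. \<forall>u\<in>cube.
     m \<le> \<kappa> 1 \<longrightarrow> m \<le> \<kappa> 2 \<longrightarrow> u 1 + 1/4 \<le> u 2 \<longrightarrow> pmf (Q \<kappa> u) 1 \<le> \<rho>)"

text \<open>The right-hand side is the conditional expectation of the next weight under
  \<open>hard_instance\<close>: arm 2 shows 1/2, arm 1 shows 0 with probability 1/4, and its reward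
  1 has weight 0. The cases are the initial rounds, arm 1 below its quota of \<open>m\<close> pulls,
  and the quota used up.\<close>

lemma weight_step:
  assumes "unradical Q" "separated_bound Q m \<rho>" "0 < m" "0 \<le> \<rho>" "\<rho> \<le> 1" "n < T"
  defines "q \<equiv> \<lambda>\<omega>. pmf (Q (pulls \<omega> n) (emp_mean \<omega> n))"
  shows "weight m \<rho> T n \<omega> \<le> q \<omega> 2 * weight m \<rho> T (Suc n) (fun_upd \<omega> n (2, 1/2)) +
    q \<omega> 1 * (1/4 * weight m \<rho> T (Suc n) (fun_upd \<omega> n (1, 0)))"
proof (cases "unlucky m n \<omega>")
  case False
  then show ?thesis by (simp add: weight_def[of _ _ _ n] weight_upd)
next
  case True
  note st = unlucky_state[OF True]
  let ?k = "pulls \<omega> n 1" and ?q = "q \<omega> 1"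
  have q2: "q \<omega> 2 = 1 - ?q"
    using sum_pmf_eq_1[of UNIV "Q (pulls \<omega> n) (emp_mean \<omega> n)"] by (simp add: UNIV_2[symmetric] q_def) (simp add: UNIV_2)
  have q0: "0 \<le> ?q" "?q \<le> 1" by (simp_all add: q_def pmf_le_1)
  have Tn: "T - n = Suc (T - Suc n)" using \<open>n < T\<close> by simp
  define W where "W = (1 - \<rho>) ^ (T - Suc n)"
  have W: "0 \<le> W" "(1 - \<rho>) ^ (T - n) = (1 - \<rho>) * W"
    using \<open>\<rho> \<le> 1\<close> by (simp_all add: W_def Tn)
  consider "n < m" | "m \<le> n" "?k < m" | "m \<le> n" "?k = m" using st(3) by linarith
  then show ?thesis
  proof cases
    \<comment> \<open>Only arm 2 keeps the event alive. Unradicality gives it probability at least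
      1/2, which pays one factor 1/2; the factor \<open>1 - \<rho>\<close> is given away.\<close>
    case 1
    have u: "\<forall>j. j \<noteq> 1 \<longrightarrow> emp_mean \<omega> n 1 \<le> emp_mean \<omega> n j"
      using st(1,2) by (auto simp: forall_2)
    have q: "?q \<le> 1/2"
      using \<open>unradical Q\<close> u unlucky_emp_mean_cube[OF True] unfolding unradical_def q_def by blast
    have mn: "m - n = Suc (m - Suc n)" using 1 by simp
    define X where "X = (1/2) ^ (m - Suc n) * (1/4) ^ (m - ?k) * W"
    have "X \<ge> 0" using W by (simp add: X_def)
    have "weight m \<rho> T n \<omega> = 1/2 * (1 - \<rho>) * X"
      using True by (simp add: weight_def W mn X_def)
    also have "\<dots> \<le> 1/2 * X"
      using \<open>X \<ge> 0\<close> \<open>0 \<le> \<rho>\<close> by (simp add: mult_left_le_one_le field_simps)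
    also have "\<dots> \<le> (1 - ?q) * X"
      using q \<open>X \<ge> 0\<close> by (intro mult_right_mono) auto
    finally show ?thesis using True 1 by (simp add: weight_upd q2 X_def W_def)
  next
    \<comment> \<open>Both arms can keep the event alive. A pull of arm 1 survives with probability
      1/4 but removes one factor 1/4 from the price, so the two branches balance for every value of
      \<open>?q\<close>.\<close>
    case 2
    have mk: "m - ?k = Suc (m - Suc ?k)" using 2 by simp
    define X where "X = (1/4) ^ (m - ?k) * W"
    have "X \<ge> 0" using W by (simp add: X_def)
    have "weight m \<rho> T n \<omega> = (1 - \<rho>) * X"
      using True 2 by (simp add: weight_def W X_def)
    also have "\<dots> \<le> X"
      using \<open>X \<ge> 0\<close> \<open>0 \<le> \<rho>\<close> by (simp add: field_simps)
    also have "X = (1 - ?q) * X + ?q * X"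
      by (simp add: algebra_simps)
    also have "?q * X = ?q * (1/4 * ((1/4) ^ (m - Suc ?k) * W))"
      by (simp add: X_def mk)
    finally show ?thesis using True 2 by (simp add: weight_upd q2 X_def W_def)
  next
    \<comment> \<open>Arm 1 must not be pulled again, and arm 2 has at least \<open>m\<close> pulls
      as well. With \<open>?j\<close> pulls its empirical mean \<open>?j / (2 * (?j + 1))\<close>
      reaches 1/4 once \<open>?j\<close> is at least 1, which explains the gap 1/4 in
      \<open>separated_bound\<close>.\<close>
    case 3
    let ?j = "real (pulls \<omega> n 2)"
    have m: "m \<le> pulls \<omega> n 2" using st(4) 3 by simp
    then have "1 \<le> ?j" using \<open>0 < m\<close> by linarith
    then have "emp_mean \<omega> n 1 + 1/4 \<le> emp_mean \<omega> n 2"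
      unfolding st(1,2) by (simp add: divide_simps)
    then have "?q \<le> \<rho>"
      using \<open>separated_bound Q m \<rho>\<close> unlucky_emp_mean_cube[OF True] m 3 unfolding separated_bound_def q_def
      by simp
    then have "(1 - \<rho>) * W \<le> (1 - ?q) * W"
      using W by (intro mult_right_mono) auto
    then show ?thesis using True 3 by (simp add: weight_upd q2 weight_def[of _ _ _ n] W) (simp add: W_def)
  qed
qed

text \<open>The expectation of \<open>weight\<close> does not decrease from time 0 to time
  \<open>T\<close>; comparing the two ends gives the bound.\<close>

lemma prob_unlucky_ge:
  assumes Q: "markov_policy Q" "unradical Q" "separated_bound Q m \<rho>" and m: "0 < m" and \<rho>: "0 \<le> \<rho>" "\<rho> \<le> 1"
  shows "(1/8) ^ m * (1 - \<rho>) ^ T \<le>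
    measure (trajectory_law hard_instance Q) {\<omega> \<in> space (trajectory_law hard_instance Q). unlucky m T \<omega>}"
proof -
  let ?L = "trajectory_law hard_instance Q"
  let ?w = "\<lambda>n \<omega>. ennreal (weight m \<rho> T n \<omega>)"
  note restrict = measurable_restrict_trajectory[OF hard_instance_in_instances Q(1)]
  have w_restrict: "?w n (restrict \<omega> {0..<n}) = ?w n \<omega>" for n \<omega>
    by (intro arg_cong[where f=ennreal] weight_cong) simp
  have w_meas: "?w n \<in> borel_measurable (Pi\<^sub>M {0..<n} (\<lambda>_. round_space))" for n
    by (intro measurable_compose[OF weight_measurable measurable_ennreal])
  interpret prob_space ?L
    by (rule prob_space_trajectory_law[OF hard_instance_in_instances Q(1)])
  have step: "(\<integral>\<^sup>+\<omega>. ?w n \<omega> \<partial>?L) \<le> (\<integral>\<^sup>+\<omega>. ?w (Suc n) \<omega> \<partial>?L)" if "n < T" for n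
  proof -
    let ?q = "\<lambda>\<omega>. pmf (Q (pulls \<omega> n) (emp_mean \<omega> n))"
    have "(\<integral>\<^sup>+\<omega>. ?w n \<omega> \<partial>?L) \<le> (\<integral>\<^sup>+\<omega>. (\<Sum>i\<in>UNIV. ennreal (?q \<omega> i) *
        (\<integral>\<^sup>+x. ?w (Suc n) (fun_upd (restrict \<omega> {0..<n}) n (i, x)) \<partial>hard_instance i)) \<partial>?L)"
    proof (rule nn_integral_mono)
      fix \<omega> assume \<omega>: "\<omega> \<in> space ?L"
      let ?r = "restrict \<omega> {0..<n}"
      have r: "weight m \<rho> T (Suc n) (fun_upd ?r n y) = weight m \<rho> T (Suc n) (fun_upd \<omega> n y)" for y
        by (rule weight_cong) auto
      have "(\<lambda>y. fun_upd ?r n y) \<in> round_space \<rightarrow>\<^sub>M Pi\<^sub>M {0..<Suc n} (\<lambda>_. round_space)"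
        using measurable_space[OF restrict \<omega>, of n] by (intro measurable_fun_upd[where J="{0..<n}"]) auto
      from measurable_compose[OF measurable_Pair_round_space[OF refl] measurable_compose[OF this w_meas]]
      have g: "(\<lambda>x. ?w (Suc n) (fun_upd ?r n (i, x))) \<in> borel_measurable unit_borel" for i .
      have "?w n \<omega> \<le> ennreal (?q \<omega> 2 * weight m \<rho> T (Suc n) (fun_upd \<omega> n (2, 1/2)) +
          ?q \<omega> 1 * (1/4 * weight m \<rho> T (Suc n) (fun_upd \<omega> n (1, 0))))"
        by (intro ennreal_leI weight_step Q m \<rho> that)
      also have "\<dots> = ennreal (?q \<omega> 2) * ?w (Suc n) (fun_upd \<omega> n (2, 1/2)) +
          ennreal (?q \<omega> 1) * (ennreal (1/4) * ?w (Suc n) (fun_upd \<omega> n (1, 0)))"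
        using weight_nonneg[OF \<rho>(2)] by (simp only: ennreal_plus ennreal_mult mult_nonneg_nonneg pmf_nonneg)
      \<comment> \<open>The outcome \<open>(1, 1)\<close> leaves the event; its nonnegative term is
        added only to complete the integral over the reward of arm 1.\<close>
      also have "\<dots> \<le> ennreal (?q \<omega> 2) * ?w (Suc n) (fun_upd \<omega> n (2, 1/2)) +
          ennreal (?q \<omega> 1) * (ennreal (3/4) * ?w (Suc n) (fun_upd \<omega> n (1, 1)) +
            ennreal (1/4) * ?w (Suc n) (fun_upd \<omega> n (1, 0)))"
        by (intro add_mono mult_left_mono) auto
      also have "\<dots> = (\<Sum>i\<in>UNIV. ennreal (?q \<omega> i) *
          (\<integral>\<^sup>+x. ?w (Suc n) (fun_upd ?r n (i, x)) \<partial>hard_instance i))"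
        unfolding sum_2 r nn_integral_hard_instance[OF g[unfolded r]] by (rule add.commute)
      finally show "?w n \<omega> \<le> \<dots>" .
    qed
    also have "\<dots> = (\<integral>\<^sup>+\<omega>. ?w (Suc n) (restrict \<omega> {0..<Suc n}) \<partial>?L)"
      by (rule nn_integral_trajectory_Suc[OF hard_instance_in_instances Q(1) w_meas, symmetric])
    finally show ?thesis by (simp only: w_restrict)
  qed
  have chain: "n \<le> T \<Longrightarrow> (\<integral>\<^sup>+\<omega>. ?w 0 \<omega> \<partial>?L) \<le> (\<integral>\<^sup>+\<omega>. ?w n \<omega> \<partial>?L)" for n
  proof (induction n)
    case (Suc n)
    with step[of n] show ?case by simp
  qed simp
  have set: "{\<omega> \<in> space ?L. unlucky m T \<omega>} \<in> sets ?L"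
  proof -
    have "Measurable.pred ?L (\<lambda>\<omega>. unlucky m T (restrict \<omega> {0..<T}))"
      by (rule measurable_compose[OF restrict pred_unlucky])
    moreover have "unlucky m T (restrict \<omega> {0..<T}) = unlucky m T \<omega>" for \<omega>
      by (rule unlucky_cong) simp
    ultimately show ?thesis by (simp add: pred_def)
  qed
  \<comment> \<open>At time 0 the event holds vacuously and the whole price is outstanding, with 1/2
    and 1/4 combining to 1/8.\<close>
  have "ennreal ((1/8) ^ m * (1 - \<rho>) ^ T) = (\<integral>\<^sup>+\<omega>. ?w 0 \<omega> \<partial>?L)"
    by (simp add: weight_def unlucky_def pulls_def emeasure_space_1 power_mult_distrib[symmetric])
  also have "\<dots> \<le> (\<integral>\<^sup>+\<omega>. ?w T \<omega> \<partial>?L)"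
    by (rule chain) simp
  \<comment> \<open>Whatever price is left at time \<open>T\<close> is at most 1.\<close>
  also have "\<dots> \<le> (\<integral>\<^sup>+\<omega>. indicator {\<omega> \<in> space ?L. unlucky m T \<omega>} \<omega> \<partial>?L)"
    by (intro nn_integral_mono) (auto simp: weight_def indicator_def intro!: mult_le_one power_le_one)
  also have "\<dots> = ennreal (measure ?L {\<omega> \<in> space ?L. unlucky m T \<omega>})"
    using set by (simp add: emeasure_eq_measure)
  finally show ?thesis by simp
qed

text \<open>On the event arm 1 has at most \<open>m\<close> pulls, hence at most half of all rounds.
  Arm 2 takes the other half at a gap of 1/4 each, whence the constant 1/8.\<close>

lemma prob_linear_regret_ge:
  assumes Q: "markov_policy Q" "unradical Q" "separated_bound Q m \<rho>" and m: "0 < m" "2 * m \<le> T"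
    and \<rho>: "0 \<le> \<rho>" "\<rho> \<le> 1"
  shows "(1/8) ^ m * (1 - \<rho>) ^ T \<le> measure (trajectory_law hard_instance Q)
    {\<omega> \<in> space (trajectory_law hard_instance Q). pseudo_regret hard_instance T \<omega> \<ge> 1/8 * real T}"
proof -
  let ?L = "trajectory_law hard_instance Q"
  interpret prob_space ?L
    by (rule prob_space_trajectory_law[OF hard_instance_in_instances Q(1)])
  have "pseudo_regret hard_instance T \<omega> \<ge> 1/8 * real T" if "unlucky m T \<omega>" for \<omega>
  proof -
    have "T \<le> 2 * pulls \<omega> T 2" using unlucky_state(3,5)[OF that] m by linarith
    then show ?thesis by (simp add: pseudo_regret_hard_instance)
  qed
  then have "measure ?L {\<omega> \<in> space ?L. unlucky m T \<omega>} \<le>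
      measure ?L {\<omega> \<in> space ?L. pseudo_regret hard_instance T \<omega> \<ge> 1/8 * real T}"
    using borel_measurable_integrable[OF integrable_pseudo_regret[OF hard_instance_in_instances Q(1)]]
    by (intro finite_measure_mono) auto
  with prob_unlucky_ge[OF Q m(1) \<rho>] show ?thesis by (rule order_trans)
qed

section \<open>Asymptotics\<close>

lemma is_Omega_I:
  assumes "c > 0" "\<forall>\<^sub>F T in sequentially. c * g T \<le> f T" "\<forall>\<^sub>F T in sequentially. g T > 0"
  shows "is_Omega f g"
proof -
  have "\<forall>\<^sub>F T in sequentially. ereal c \<le> ereal (f T / g T)"
    using assms(2,3) by eventually_elim (simp add: field_simps)
  then have "ereal c \<le> liminf (\<lambda>T. ereal (f T / g T))"
    by (rule Liminf_bounded)
  moreover have "0 < ereal c" using \<open>c > 0\<close> by simp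
  ultimately show ?thesis unfolding is_Omega_def by (rule less_le_trans[rotated])
qed

lemma is_Omega_powr_o1_I:
  assumes "\<eta> \<longlonglongrightarrow> 0" "c > 0" "\<forall>\<^sub>F T in sequentially. c * real T powr (b - \<eta> T) \<le> f T"
  shows "is_Omega_powr_o1 f b"
proof -
  have "\<forall>\<^sub>F T in sequentially. real T powr (b - \<eta> T) > 0"
    by (rule eventually_mono[OF eventually_gt_at_top[of "0::nat"]]) auto
  then have "is_Omega f (\<lambda>T. real T powr (b - \<eta> T))"
    by (rule is_Omega_I[OF assms(2,3)])
  with assms(1) show ?thesis unfolding is_Omega_powr_o1_def by blast
qed

text \<open>Irreversibility speaks about one sequence of states at a time; applied to a sequence of
  violating states it becomes uniform over all separated states.\<close>

lemma irreversible_uniform: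
  assumes "irreversible \<alpha> Q" "0 < \<delta>" "\<delta> < 2 * \<alpha>" "j \<noteq> 1" "0 < \<epsilon>" "\<epsilon> \<le> 1"
  defines "L \<equiv> \<lambda>T. ln (real T) powr (1 / (2 * \<alpha> - \<delta>))"
  shows "\<forall>\<^sub>F T in sequentially. \<forall>\<kappa>. \<forall>u\<in>cube. L T \<le> real (\<kappa> 1) \<longrightarrow> L T \<le> real (\<kappa> j) \<longrightarrow>
    u 1 + \<epsilon> \<le> u j \<longrightarrow> pmf (Q \<kappa> u) 1 \<le> L T / real T"
proof -
  define separated where "separated = (\<lambda>T (\<kappa>, u). u \<in> cube \<and> L T \<le> real (\<kappa> 1) \<and> L T \<le> real (\<kappa> j) \<and> u 1 + \<epsilon> \<le> u j)"
  define viol where "viol = (\<lambda>T (\<kappa>, u). separated T (\<kappa>, u) \<and> \<not> pmf (Q \<kappa> u) 1 \<le> L T / real T)"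
  \<comment> \<open>A violating state is selected whenever one exists, and some separated state
    otherwise, so that the selected sequence meets the hypotheses of irreversibility at every
    \<open>T\<close>.\<close>
  have "\<exists>p. separated T p \<and> ((\<exists>s. viol T s) \<longrightarrow> viol T p)" for T
  proof (cases "\<exists>s. viol T s")
    case True
    then show ?thesis by (auto simp: viol_def)
  next
    case False
    \<comment> \<open>The default state has gap 1, which is where \<open>\<epsilon> \<le> 1\<close>
      enters.\<close>
    have "separated T (\<lambda>_. nat \<lceil>L T\<rceil>, \<lambda>i. if i = j then 1 else 0)"
      using assms(4,6) by (auto simp: separated_def cube_def intro: real_nat_ceiling_ge)
    with False show ?thesis by blast
  qed
  then obtain p where p: "\<And>T. separated T (p T)" "\<And>T s. viol T s \<Longrightarrow> viol T (p T)" by metis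
  let ?\<kappa> = "\<lambda>T. fst (p T)" and ?u = "\<lambda>T. snd (p T)"
  have sep: "?u T \<in> cube" "L T \<le> real (?\<kappa> T 1)" "L T \<le> real (?\<kappa> T j)" "?u T 1 + \<epsilon> \<le> ?u T j" for T
    using p(1)[of T] by (auto simp: separated_def split: prod.splits)
  have "is_Omega (\<lambda>T. ?u T j - ?u T 1) (\<lambda>_. 1)"
    using \<open>0 < \<epsilon>\<close> sep(4) by (intro is_Omega_I[of \<epsilon>]) (auto simp: algebra_simps)
  then have "\<forall>\<^sub>F T in sequentially. pmf (Q (?\<kappa> T) (?u T)) 1 \<le> L T / real T"
    using assms(1)[unfolded irreversible_def, rule_format, of \<delta> j ?u ?\<kappa>] assms(2-4) sep
    unfolding L_def by auto
  then show ?thesis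
  proof eventually_elim
    case (elim T)
    then have "\<not> viol T (p T)" by (auto simp: viol_def split: prod.splits)
    then have "\<not> viol T (\<kappa>, u)" for \<kappa> u using p(2) by blast
    then show ?case by (auto simp: viol_def separated_def)
  qed
qed

section \<open>Choice of parameters and conclusion\<close>

theorem theorem6:
  fixes \<alpha> :: real and Q :: "2 policy"
  assumes "\<alpha> > 1 / 2"
    and "markov_policy Q" and "anonymous Q" and "unradical Q" and "irreversible \<alpha> Q"
  shows "(\<exists>\<Theta>\<in>instances. \<exists>c>0.
            is_Omega_powr_o1
              (\<lambda>T. measure (trajectory_law \<Theta> Q)
                 {\<omega> \<in> space (trajectory_law \<Theta> Q). pseudo_regret \<Theta> T \<omega> \<ge> c * real T}) 0)
       \<and> is_Omega_powr_o1 (worst_case_regret Q) 1"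
proof -
  \<comment> \<open>Makes \<open>2 * \<alpha> - \<delta>\<close> equal to
    \<open>\<alpha> + 1/2\<close>, which exceeds 1. Hence \<open>s < 1\<close>, and \<open>L\<close>
    is of smaller order than the logarithm.\<close>
  define \<delta> where "\<delta> = \<alpha> - 1/2"
  define s where "s = 1 / (2 * \<alpha> - \<delta>)"
  have \<delta>: "0 < \<delta>" "\<delta> < 2 * \<alpha>" and s: "0 < s" "s < 1"
    using assms(1) by (auto simp: \<delta>_def s_def)
  define L where "L = (\<lambda>T::nat. ln (real T) powr s)"
  \<comment> \<open>Chosen so that \<open>real T powr (- \<eta> T)\<close> equals
    \<open>exp (- 8 * L T)\<close>; it vanishes in the limit because \<open>s < 1\<close>.\<close>
  define \<eta> where "\<eta> = (\<lambda>T::nat. 8 * ln (real T) powr (s - 1))"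
  let ?P = "\<lambda>T. measure (trajectory_law hard_instance Q)
    {\<omega> \<in> space (trajectory_law hard_instance Q). pseudo_regret hard_instance T \<omega> \<ge> 1/8 * real T}"
  have \<eta>: "\<eta> \<longlonglongrightarrow> 0"
    unfolding \<eta>_def using s by real_asymp
  \<comment> \<open>For \<open>m\<close>, the ceiling of \<open>L T\<close>, these give
    \<open>m \<le> L T + 1 \<le> 2 * L T\<close>, hence \<open>2 * m \<le> 4 * L T \<le> T\<close>,
    and they put \<open>L T / T\<close> below 1/2.\<close>
  have ev: "\<forall>\<^sub>F T in sequentially. 1 \<le> L T" "\<forall>\<^sub>F T in sequentially. 6 * L T \<le> real T"
    unfolding L_def using s by real_asymp+
  have uniform: "\<forall>\<^sub>F T in sequentially. \<forall>\<kappa>. \<forall>u\<in>cube. L T \<le> real (\<kappa> 1) \<longrightarrow> L T \<le> real (\<kappa> 2) \<longrightarrow>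
      u 1 + 1/4 \<le> u 2 \<longrightarrow> pmf (Q \<kappa> u) 1 \<le> L T / real T"
    using irreversible_uniform[OF assms(5) \<delta>, of 2 "1/4"] by (simp add: L_def s_def)
  have P: "\<forall>\<^sub>F T in sequentially. real T powr (- \<eta> T) \<le> ?P T"
    using uniform ev eventually_ge_at_top[of "3::nat"]
  proof eventually_elim
    case (elim T)
    define m where "m = nat \<lceil>L T\<rceil>"
    define \<rho> where "\<rho> = L T / real T"
    have m: "L T \<le> real m" "real m \<le> 2 * L T" "0 < m" "2 * m \<le> T"
      using elim by (auto simp: m_def) linarith+
    have \<rho>: "0 \<le> \<rho>" "\<rho> \<le> 1/2" "\<rho> * real T = L T"
      using elim by (auto simp: \<rho>_def field_simps)
    have "separated_bound Q m \<rho>"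
      using elim(1) m(1) unfolding separated_bound_def \<rho>_def
      by (meson of_nat_mono order_trans)
    from prob_linear_regret_ge[OF assms(2,4) this m(3,4) \<rho>(1)] \<rho>
    have le: "(1/8) ^ m * (1 - \<rho>) ^ T \<le> ?P T" by simp
    have "L T = ln (real T) powr (s - 1) * ln (real T)"
      using elim by (simp add: L_def powr_diff)
    \<comment> \<open>The exponent \<open>8 * L T\<close> is split: \<open>6 * L T\<close> covers 3
      for each of the \<open>m\<close> factors 1/8, since \<open>m \<le> 2 * L T\<close>, and
      \<open>2 * L T\<close> is exactly \<open>2 * \<rho>\<close> for each of the \<open>T\<close>
      factors \<open>1 - \<rho>\<close>.\<close>
    then have "real T powr (- \<eta> T) = exp (- 6 * L T) * exp (- 2 * L T)"
      using elim by (simp add: powr_def \<eta>_def exp_add[symmetric])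
    also have "\<dots> \<le> exp (real m * (- 3)) * exp (real T * (- 2 * \<rho>))"
      using m(2) \<rho>(3) by (intro mult_mono) (auto simp: algebra_simps)
    also have "\<dots> = exp (- 3) ^ m * exp (- 2 * \<rho>) ^ T"
      by (simp only: exp_of_nat_mult)
    also have "\<dots> \<le> (1/8) ^ m * (1 - \<rho>) ^ T"
    proof (intro mult_mono power_mono)
      have "(2::real) ^ 3 \<le> exp 1 ^ 3" using exp_ge_add_one_self[of 1] by (intro power_mono) auto
      then show "exp (- 3) \<le> (1/8 :: real)" by (simp add: exp_minus exp_of_nat_mult[symmetric] divide_simps)
      show "exp (- 2 * \<rho>) \<le> 1 - \<rho>"
      proof -
        \<comment> \<open>The product equals \<open>1 + \<rho> * (1 - 2 * \<rho>)\<close>, so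
          \<open>\<rho> \<le> 1/2\<close> suffices.\<close>
        have "1 \<le> (1 - \<rho>) * (1 + 2 * \<rho>)"
          using mult_nonneg_nonneg[of \<rho> "1 - 2 * \<rho>"] \<rho>(1,2) by (simp add: algebra_simps)
        also have "\<dots> \<le> (1 - \<rho>) * exp (2 * \<rho>)"
          using \<rho>(2) exp_ge_add_one_self[of "2 * \<rho>"] by (intro mult_left_mono) auto
        finally show ?thesis by (simp add: exp_minus divide_simps)
      qed
    qed (use \<rho> in auto)
    finally show ?case using le by linarith
  qed
  have "is_Omega_powr_o1 ?P 0"
    by (rule is_Omega_powr_o1_I[OF \<eta>, of 1]) (use P in simp_all)
  moreover have "is_Omega_powr_o1 (worst_case_regret Q) 1"
  proof (rule is_Omega_powr_o1_I[OF \<eta>, of "1/8"])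
    show "\<forall>\<^sub>F T in sequentially. 1/8 * real T powr (1 - \<eta> T) \<le> worst_case_regret Q T"
      using P eventually_gt_at_top[of "0::nat"]
    proof eventually_elim
      case (elim T)
      have "1/8 * real T powr (1 - \<eta> T) = 1/8 * real T * real T powr (- \<eta> T)"
        using elim powr_add[of "real T" 1 "- \<eta> T"] by simp
      also have "\<dots> \<le> 1/8 * real T * ?P T"
        using elim by (intro mult_left_mono) auto
      \<comment> \<open>Markov's inequality at the level \<open>T/8\<close>; this level supplies the
        factor \<open>T\<close> that raises the exponent from 0 to 1.\<close>
      also have "\<dots> \<le> regret hard_instance Q T"
        using elim by (intro regret_ge_prob hard_instance_in_instances assms(2)) auto
      also have "\<dots> \<le> worst_case_regret Q T"
        by (rule regret_le_worst_case[OF hard_instance_in_instances assms(2)])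
      finally show ?case .
    qed
  qed simp
  ultimately show ?thesis
    using hard_instance_in_instances by (intro conjI bexI[of _ hard_instance] exI[of _ "1/8"]) auto
qed

end
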